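(* Let $m\ge 1$ be an integer, and let $R_{m,2}$ be the minimum positive root of the equation $\psi_m(r)=0$, where $$\psi_m(r)=2r^2-(1-r^{2m})(1-r^m-r).$$ Then for every $f\in\mathcal{B}$, $$|f(z^m)| + \sum_{k=2}^\infty \left|\frac{f^{(k)}(z^m)}{k!}\right|r^k \le 1\quad\text{for all } z\in\mathbb{D} \text{ with } |z|=r \le R_{m,2}.$$ Moreover, the constant $R_{m,2}$ cannot be improved, i.e. it cannot be replaced by any larger number: for every $R'\in(R_{m,2},1)$ there exist $f\in\mathcal{B}$ and $z$ with $|z|=r\le R'$ for which the left-hand side (as an element of $[0,\infty]$) is greater than $1$.
   Context: $\mathbb{D}=\{z\in\mathbb{C}: |z|<1\}$, and $\mathcal{B}$ is the set of analytic functions $f$ in $\mathbb{D}$ with $|f(z)|<1$ for all $z\in\mathbb{D}$. $f^{(k)}$ denotes the $k$-th complex derivative. *)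

theory Defs
  imports "HOL-Complex_Analysis.Complex_Analysis"
begin

definition schur_class :: "(complex \<Rightarrow> complex) set" where
  "schur_class = {f. f holomorphic_on ball 0 1 \<and> (\<forall>z\<in>ball 0 1. cmod (f z) < 1)}"

definition psi :: "nat \<Rightarrow> real \<Rightarrow> real" where
  "psi m r = 2 * r\<^sup>2 - (1 - r ^ (2 * m)) * (1 - r ^ m - r)"

definition R2 :: "nat \<Rightarrow> real" where
  "R2 m = (LEAST r. 0 < r \<and> psi m r = 0)"

text \<open>The series starts at the second derivative, hence the index shift. It may diverge, so it is
  taken in the extended non-negative reals.\<close>

definition bohr_sum :: "nat \<Rightarrow> (complex \<Rightarrow> complex) \<Rightarrow> complex \<Rightarrow> ennreal" where
  "bohr_sum m f z = ennreal (cmod (f (z ^ m))) +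
     (\<Sum>k. ennreal (cmod ((deriv ^^ (k + 2)) f (z ^ m) / fact (k + 2)) * cmod z ^ (k + 2)))"

text \<open>The minimum positive root exists and lies in the unit interval, so the \<open>LEAST\<close> above is
  well defined.\<close>

lemma R2_is_min_root:
  assumes "m \<ge> 1"
  shows "0 < R2 m" "psi m (R2 m) = 0" "\<And>r. 0 < r \<Longrightarrow> psi m r = 0 \<Longrightarrow> R2 m \<le> r" "R2 m < 1"
proof -
  define S where "S = {0..1} \<inter> psi m -` {0}"
  have cont: "continuous_on {0..1} (psi m)"
    unfolding psi_def by (intro continuous_intros)
  have 0: "psi m 0 = -1" and 1: "psi m 1 = 2"
    using assms by (auto simp: psi_def power_0_left)
  have "\<exists>x\<ge>0. x \<le> 1 \<and> psi m x = 0"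
    by (rule IVT') (use 0 1 cont in auto)
  then have ne: "S \<noteq> {}"
    by (auto simp: S_def)
  have "closed S"
    unfolding S_def by (rule continuous_closed_preimage[OF cont]) auto
  then have "compact S"
    using bounded_subset[OF bounded_closed_interval, of S 0 1]
    by (auto simp: S_def compact_eq_bounded_closed)
  then obtain s where s: "s \<in> S" "\<And>t. t \<in> S \<Longrightarrow> s \<le> t"
    using compact_attains_inf[OF _ ne] by blast
  have "s \<noteq> 0" "s \<noteq> 1"
    using s(1) 0 1 by (auto simp: S_def)
  then have s01: "0 < s" "s < 1" "psi m s = 0"
    using s(1) by (auto simp: S_def)
  have min: "s \<le> r" if "0 < r" "psi m r = 0" for r
    using that s(2)[of r] s01 by (cases "r \<le> 1") (auto simp: S_def)
  have "R2 m = s"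
    unfolding R2_def by (rule Least_equality) (use s01 min in auto)
  then show "0 < R2 m" "psi m (R2 m) = 0" "\<And>r. 0 < r \<Longrightarrow> psi m r = 0 \<Longrightarrow> R2 m \<le> r" "R2 m < 1"
    using s01 min by auto
qed

end

theory Submission imports Defs begin

text \<open>Put \<open>w = z ^ m\<close>, \<open>r = |z|\<close> and \<open>\<rho> = r ^ m\<close>. Ruscheweyh's inequality
  \<open>|f^(k)(w)| / k! \<le> (1 - |f w|^2) / ((1 - \<rho>^2) (1 - \<rho>)^(k - 1))\<close> and summation of a geometric
  series bound the left-hand side by \<open>x + (1 - x^2) r^2 / ((1 - \<rho>^2) (1 - \<rho> - r))\<close> with
  \<open>x = |f w|\<close>. If \<open>psi m r \<le> 0\<close>, the factor of \<open>1 - x^2\<close> is at most \<open>1 / 2\<close>, and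
  \<open>x + (1 - x^2) / 2 \<le> 1\<close>. For \<open>r\<close> slightly larger than the root, \<open>psi m r > 0\<close>, and the
  functions \<open>(a - z) / (1 - a z)\<close> violate the inequality at \<open>z = r\<close> once \<open>a < 1\<close> is close to \<open>1\<close>.\<close>

section \<open>Taylor coefficients at the origin\<close>

text \<open>Cauchy's estimate on the circle of radius \<open>r < 1\<close>, where \<open>f\<close>
  is still continuous up to the boundary, leaves a factor \<open>r ^ n\<close>, which tends to 1 as
  \<open>r\<close> tends to 1 from below.\<close>

lemma schur_class_higher_deriv_bound:
  assumes f: "f \<in> schur_class" and n: "0 < n"
  shows "cmod ((deriv ^^ n) f 0 / fact n) \<le> 1"
proof -
  have hol: "f holomorphic_on ball 0 1" and bd: "\<And>z. cmod z < 1 \<Longrightarrow> cmod (f z) < 1"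
    using f by (auto simp: schur_class_def)
  have *: "cmod ((deriv ^^ n) f 0 / fact n) * r ^ n \<le> 1" if r: "0 < r" "r < 1" for r
  proof -
    have "cmod ((deriv ^^ n) f 0) \<le> fact n * 1 / r ^ n"
    proof (rule Cauchy_higher_deriv_bound[where y = 0])
      show "f holomorphic_on ball 0 r"
        using r by (intro holomorphic_on_subset[OF hol]) auto
      show "continuous_on (cball 0 r) f"
        using r by (intro holomorphic_on_imp_continuous_on holomorphic_on_subset[OF hol]) auto
    qed (use r n bd in auto)
    then show ?thesis
      using r by (simp add: field_simps norm_divide)
  qed
  have "((\<lambda>r. cmod ((deriv ^^ n) f 0 / fact n) * r ^ n) \<longlongrightarrow>
      cmod ((deriv ^^ n) f 0 / fact n) * 1 ^ n) (at_left (1::real))"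
    by (intro tendsto_intros)
  moreover have "\<forall>\<^sub>F r in at_left (1::real). cmod ((deriv ^^ n) f 0 / fact n) * r ^ n \<le> 1"
    using eventually_at_left_real[of 0 "1::real"] by (rule eventually_mono) (use * in auto)
  ultimately show ?thesis
    using tendsto_upperbound[of _ "cmod ((deriv ^^ n) f 0 / fact n) * 1 ^ n" "at_left (1::real)" 1]
    by simp
qed

lemma schur_class_has_fps_expansion:
  assumes "f \<in> schur_class" "cmod w < 1"
  shows "(\<lambda>u. f (w + u)) has_fps_expansion fps_expansion f w"
  using assms
  by (intro analytic_at_imp_has_fps_expansion)
     (auto simp: schur_class_def analytic_at intro!: exI[of _ "ball 0 1"])

lemma schur_class_Moebius_comp:
  assumes "f \<in> schur_class" "cmod c < 1"
  shows "(\<lambda>z. Moebius_function 0 c (f z)) \<in> schur_class"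
proof -
  have "Moebius_function 0 c \<circ> f holomorphic_on ball 0 1"
    using assms Moebius_function_holomorphic[of c 0]
    by (intro holomorphic_on_compose_gen[where t = "ball 0 1"]) (auto simp: schur_class_def)
  then show ?thesis
    using assms Moebius_function_norm_lt_1 by (auto simp: schur_class_def o_def)
qed

lemma schur_class_comp_Moebius:
  assumes "f \<in> schur_class" "cmod c < 1"
  shows "(\<lambda>z. f (Moebius_function 0 c z)) \<in> schur_class"
proof -
  have "f \<circ> Moebius_function 0 c holomorphic_on ball 0 1"
    using assms Moebius_function_holomorphic[of c 0] Moebius_function_norm_lt_1[of c]
    by (intro holomorphic_on_compose_gen[where t = "ball 0 1"]) (auto simp: schur_class_def)
  then show ?thesis
    using assms Moebius_function_norm_lt_1 by (auto simp: schur_class_def o_def)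
qed

text \<open>Composing with the disc automorphism that sends \<open>c = f 0\<close> to 0 stays in the
  class. Since the lower coefficients vanish, the first-order effect of this map is all that reaches
  index \<open>n\<close>: the coefficient there is divided by 1 - |c|^2, and Cauchy's bound by 1
  applies to the quotient.\<close>

lemma schur_class_gap_coeff_bound:
  assumes f: "f \<in> schur_class" and n: "0 < n"
    and gap: "\<And>k. 0 < k \<Longrightarrow> k < n \<Longrightarrow> (deriv ^^ k) f 0 = 0"
  shows "cmod ((deriv ^^ n) f 0 / fact n) \<le> 1 - (cmod (f 0))\<^sup>2"
proof -
  define c where "c = f 0"
  define F where "F = fps_expansion f 0"
  define D where "D = 1 - fps_const (cnj c) * F"
  have c1: "cmod c < 1"
    using f by (auto simp: schur_class_def c_def)
  have F: "f has_fps_expansion F"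
    using schur_class_has_fps_expansion[OF f, of 0] by (simp add: F_def)
  have Fn: "fps_nth F k = (deriv ^^ k) f 0 / fact k" for k
    by (simp add: F_def fps_expansion_def)
  have c2: "1 - cnj c * c = of_real (1 - (cmod c)\<^sup>2)" 
    by (simp add: complex_norm_square[symmetric] mult.commute)
  have pos: "0 < 1 - (cmod c)\<^sup>2"
    using c1 by (simp add: power_less_one_iff abs_square_less_1)
  have D0: "fps_nth D 0 = of_real (1 - (cmod c)\<^sup>2)"
    using c2 by (simp add: D_def Fn c_def)
  have "(\<lambda>z. (f z - c) / (1 - cnj c * f z)) has_fps_expansion (F - fps_const c) / D"
    unfolding D_def
    by (intro fps_expansion_intros F) (use D0 pos in \<open>simp add: D_def del: of_real_diff\<close>)
  then have M: "(\<lambda>z. Moebius_function 0 c (f z)) has_fps_expansion (F - fps_const c) * inverse D"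
    using D0 pos by (simp add: Moebius_function_simple fps_divide_unit del: of_real_diff)
  have "fps_nth ((F - fps_const c) * inverse D) n =
      (\<Sum>i=0..n. fps_nth (F - fps_const c) i * fps_nth (inverse D) (n - i))"
    by (simp add: fps_mult_nth)
  \<comment> \<open>Index 0 drops out because \<open>f 0 = c\<close>, the indices strictly between 0
    and \<open>n\<close> by \<open>gap\<close>. What remains is multiplied by the constant
    coefficient of \<open>inverse D\<close>.\<close>
  also have "\<dots> = (\<Sum>i\<in>{n}. fps_nth (F - fps_const c) i * fps_nth (inverse D) (n - i))"
  proof (rule sum.mono_neutral_right)
    show "\<forall>i\<in>{0..n} - {n}. fps_nth (F - fps_const c) i * fps_nth (inverse D) (n - i) = 0"
    proof
      fix i assume "i \<in> {0..n} - {n}"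
      then show "fps_nth (F - fps_const c) i * fps_nth (inverse D) (n - i) = 0"
        using gap[of i] by (cases "i = 0") (auto simp: Fn c_def)
    qed
  qed auto
  also have "\<dots> = (deriv ^^ n) f 0 / fact n / of_real (1 - (cmod c)\<^sup>2)"
    using n D0 by (simp add: Fn divide_inverse del: of_real_diff)
  finally have "(deriv ^^ n) (\<lambda>z. Moebius_function 0 c (f z)) 0 / fact n =
      (deriv ^^ n) f 0 / fact n / of_real (1 - (cmod c)\<^sup>2)"
    using fps_nth_fps_expansion[OF M] by simp
  moreover have "cmod ((deriv ^^ n) (\<lambda>z. Moebius_function 0 c (f z)) 0 / fact n) \<le> 1"
    by (intro schur_class_higher_deriv_bound schur_class_Moebius_comp f c1 n)
  ultimately have "cmod ((deriv ^^ n) f 0 / fact n / of_real (1 - (cmod c)\<^sup>2)) \<le> 1"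
    by simp
  then have "cmod ((deriv ^^ n) f 0 / fact n) / (1 - (cmod c)\<^sup>2) \<le> 1"
    using pos by (simp only: norm_divide[of _ "of_real _"] norm_of_real abs_of_pos)
  then show ?thesis
    using pos by (simp add: c_def divide_le_eq)
qed

lemma cis_root_unity_power:
  assumes "0 < n"
  shows "cis (2 * pi / real n) ^ n = 1"
proof -
  have "cis (2 * pi / real n) ^ n = cis (real n * (2 * pi / real n))"
    by (rule Complex.DeMoivre)
  also have "real n * (2 * pi / real n) = 2 * pi"
    using assms by simp
  finally show ?thesis
    by simp
qed

text \<open>A finite geometric sum with ratio \<open>q\<close>: the ratio satisfies
  \<open>q ^ n = 1\<close>, and it differs from 1 because \<open>n\<close> does not divide
  \<open>k\<close>.\<close>

lemma sum_powers_root_unity: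
  assumes "0 < k" "k < n"
  shows "(\<Sum>j<n. (cis (2 * pi / real n) ^ j) ^ k) = 0"
proof -
  define q where "q = cis (2 * pi / real n) ^ k"
  have "cis (2 * pi / real n) ^ n = 1"
    using assms by (intro cis_root_unity_power) simp
  then have "q ^ n = 1"
    by (metis q_def power_mult mult.commute power_one)
  moreover have "q \<noteq> 1"
  proof
    assume "q = 1"
    then have "cos (real k * (2 * pi / real n)) = 1"
      by (simp add: q_def Complex.DeMoivre complex_eq_iff)
    then obtain i :: int where i: "real k * (2 * pi / real n) = of_int i * (2 * pi)"
      by (auto simp: cos_one_2pi_int)
    have "real k = of_int i * real n"
      using i assms by (simp add: field_simps)
    then have "int k = i * int n"
      by (metis of_int_eq_iff of_int_mult of_int_of_nat_eq)
    then have "int n dvd int k"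
      by simp
    then show False
      using assms by (auto dest: dvd_imp_le)
  qed
  ultimately have "(\<Sum>j<n. q ^ j) = 0"
    by (simp add: geometric_sum)
  then show ?thesis
    by (simp add: q_def power_mult[symmetric] mult.commute)
qed

text \<open>Averaging over the rotations by \<open>n\<close>-th roots of unity removes the coefficients of index
  strictly between \<open>0\<close> and \<open>n\<close> and keeps those of index \<open>0\<close> and \<open>n\<close>.\<close>

lemma schur_class_coeff_bound:
  assumes f: "f \<in> schur_class" and n: "0 < n"
  shows "cmod ((deriv ^^ n) f 0 / fact n) \<le> 1 - (cmod (f 0))\<^sup>2"
proof -
  define \<omega> where "\<omega> = cis (2 * pi / real n)"
  have hol: "f holomorphic_on ball 0 1" and bd: "\<And>z. cmod z < 1 \<Longrightarrow> cmod (f z) < 1"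
    using f by (auto simp: schur_class_def)
  have norm_\<omega>: "cmod (\<omega> ^ j * z) = cmod z" for j z
    by (simp add: \<omega>_def norm_mult norm_power)
  define h where "h = (\<lambda>z. (1 / of_nat n) * (\<Sum>j<n. f (\<omega> ^ j * z)))"
  have holj: "(\<lambda>z. f (\<omega> ^ j * z)) holomorphic_on ball 0 1" for j
  proof -
    have "f \<circ> (\<lambda>z. \<omega> ^ j * z) holomorphic_on ball 0 1"
      using norm_\<omega> by (intro holomorphic_on_compose_gen[OF _ hol] holomorphic_intros) auto
    then show ?thesis by (simp add: o_def)
  qed
  have derivj: "(deriv ^^ k) (\<lambda>z. f (\<omega> ^ j * z)) 0 = (\<omega> ^ j) ^ k * (deriv ^^ k) f 0" for j k
    using norm_\<omega>
    by (subst higher_deriv_compose_linear[OF hol, where S = "ball 0 1"]) auto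
  have expj: "(\<lambda>z. f (\<omega> ^ j * z)) has_fps_expansion fps_expansion (\<lambda>z. f (\<omega> ^ j * z)) 0" for j
    using holj[of j] by (intro has_fps_expansion_fps_expansion[of "ball 0 1"]) auto
  have "h has_fps_expansion
      fps_const (1 / of_nat n) * (\<Sum>j<n. fps_expansion (\<lambda>z. f (\<omega> ^ j * z)) 0)"
    unfolding h_def by (intro fps_expansion_intros expj)
  from fps_nth_fps_expansion[OF this]
  have "(deriv ^^ k) h 0 / fact k =
      (1 / of_nat n) * (\<Sum>j<n. (\<omega> ^ j) ^ k) * (deriv ^^ k) f 0 / fact k" for k
    by (simp add: fps_sum_nth fps_expansion_def derivj sum_distrib_right flip: sum_divide_distrib)
  then have dh: "(deriv ^^ k) h 0 = (1 / of_nat n) * (\<Sum>j<n. (\<omega> ^ j) ^ k) * (deriv ^^ k) f 0" for k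
    by (metis divide_cancel_right fact_nonzero)
  have h: "h \<in> schur_class"
  proof -
    have "cmod (h z) < 1" if z: "cmod z < 1" for z
    proof -
      have "cmod (\<Sum>j<n. f (\<omega> ^ j * z)) \<le> (\<Sum>j<n. cmod (f (\<omega> ^ j * z)))"
        by (rule norm_sum)
      also have "\<dots> < (\<Sum>j<n. 1)"
        using n z norm_\<omega> by (intro sum_strict_mono bd) auto
      finally show ?thesis
        using n by (simp add: h_def norm_mult norm_divide field_simps)
    qed
    moreover have "h holomorphic_on ball 0 1"
      unfolding h_def by (intro holomorphic_intros holj)
    ultimately show ?thesis
      by (simp add: schur_class_def)
  qed
  have "\<omega> ^ n = 1"
    using n by (simp add: \<omega>_def cis_root_unity_power)
  then have "(\<omega> ^ j) ^ n = 1" for j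
    by (metis power_mult mult.commute power_one)
  then have "(deriv ^^ n) h 0 = (deriv ^^ n) f 0"
    using n by (simp add: dh)
  moreover have "h 0 = f 0"
    using n by (simp add: h_def)
  moreover have "(deriv ^^ k) h 0 = 0" if "0 < k" "k < n" for k
    using sum_powers_root_unity[OF that] by (simp add: dh \<omega>_def)
  ultimately show ?thesis
    using schur_class_gap_coeff_bound[OF h n] by simp
qed

section \<open>Ruscheweyh's inequality at an arbitrary point of the disc\<close>

text \<open>\<open>P\<close> is the series of u / (s - b u). Comparing coefficients after
  multiplying \<open>P ^ Suc n\<close> by the denominator yields a recurrence in \<open>n\<close>
  and \<open>k\<close>; summing its absolute values over \<open>n\<close> shows that each step in
  \<open>k\<close> costs at most the factor (1 + |b|) / s.\<close>

lemma sum_norm_power_Moebius_fps_le: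
  fixes P :: "complex fps" and b :: complex and s :: real
  assumes P: "P * (fps_const (of_real s) - fps_const b * fps_X) = fps_X" and s: "0 < s"
  shows "(\<Sum>n\<le>k. cmod (fps_nth (P ^ Suc n) (Suc k))) \<le> ((1 + cmod b) / s) ^ k / s"
proof -
  have rec: "fps_nth (P ^ Suc n) (Suc k) =
      (fps_nth (P ^ n) k + b * fps_nth (P ^ Suc n) k) / of_real s" for n k
  proof -
    have "P ^ Suc n * (fps_const (of_real s) - fps_const b * fps_X) = P ^ n * fps_X"
      by (metis P mult.assoc power_Suc2)
    then have "P ^ Suc n * fps_const (of_real s) - fps_const b * (P ^ Suc n * fps_X) = P ^ n * fps_X"
      by (simp add: algebra_simps)
    from arg_cong[OF this, of "\<lambda>F. fps_nth F (Suc k)"]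
    show ?thesis
      using s by (simp add: field_simps del: power_Suc)
  qed
  have P0: "fps_nth P 0 = 0"
    using arg_cong[OF P, of "\<lambda>F. fps_nth F 0"] s by simp
  show ?thesis
  proof (induction k)
    case 0
    show ?case
      using rec[of 0 0] s P0 by (simp add: norm_divide)
  next
    case (Suc k)
    let ?S = "\<Sum>n\<le>k. cmod (fps_nth (P ^ Suc n) (Suc k))"
    have "(\<Sum>n\<le>Suc k. cmod (fps_nth (P ^ Suc n) (Suc (Suc k)))) \<le>
        (\<Sum>n\<le>Suc k. (cmod (fps_nth (P ^ n) (Suc k)) + cmod b * cmod (fps_nth (P ^ Suc n) (Suc k))) / s)"
    proof (rule sum_mono)
      fix n
      have "cmod (fps_nth (P ^ Suc n) (Suc (Suc k))) =
          cmod (fps_nth (P ^ n) (Suc k) + b * fps_nth (P ^ Suc n) (Suc k)) / s"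
        using s by (subst rec) (simp add: norm_divide)
      also have "\<dots> \<le> (cmod (fps_nth (P ^ n) (Suc k)) + cmod b * cmod (fps_nth (P ^ Suc n) (Suc k))) / s"
        using s by (intro divide_right_mono order_trans[OF norm_triangle_ineq]) (auto simp: norm_mult)
      finally show "cmod (fps_nth (P ^ Suc n) (Suc (Suc k))) \<le> \<dots>" .
    qed
    also have "\<dots> = ((\<Sum>n\<le>Suc k. cmod (fps_nth (P ^ n) (Suc k))) +
        cmod b * (\<Sum>n\<le>Suc k. cmod (fps_nth (P ^ Suc n) (Suc k)))) / s"
      by (simp only: sum_divide_distrib[symmetric] sum.distrib sum_distrib_left)
    \<comment> \<open>Both sums reduce to \<open>?S\<close> by losing one term: here
      \<open>n = 0\<close>, since \<open>P ^ 0 = 1\<close> has no coefficient of positive index; in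
      the next one \<open>n = Suc k\<close>, since \<open>P\<close> has no constant term and its
      power therefore starts at index \<open>k + 2\<close>.\<close>
    also have "(\<Sum>n\<le>Suc k. cmod (fps_nth (P ^ n) (Suc k))) = ?S"
      by (subst sum.atMost_Suc_shift) simp
    also have "(\<Sum>n\<le>Suc k. cmod (fps_nth (P ^ Suc n) (Suc k))) = ?S"
      using startsby_zero_power_prefix[OF P0, of "Suc (Suc k)"] by (simp del: power_Suc)
    also have "(?S + cmod b * ?S) / s = (1 + cmod b) / s * ?S"
      by (simp add: algebra_simps)
    also have "\<dots> \<le> (1 + cmod b) / s * (((1 + cmod b) / s) ^ k / s)"
      using s by (intro mult_left_mono Suc.IH) auto
    finally show ?case
      by simp
  qed
qed

text \<open>Ruscheweyh's inequality. Writing \<open>f\<close> near \<open>w\<close> as \<open>g \<circ> \<phi>\<close> with \<open>\<phi>\<close> the disc automorphism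
  sending \<open>w\<close> to \<open>0\<close>, the coefficients of \<open>g\<close> obey the bound at the origin and those of the powers
  of \<open>\<phi>\<close> satisfy a linear recurrence.\<close>

lemma schur_class_higher_deriv_bound_at:
  assumes f: "f \<in> schur_class" and w: "cmod w < 1"
  shows "cmod ((deriv ^^ Suc k) f w / fact (Suc k)) \<le>
    (1 - (cmod (f w))\<^sup>2) / (1 - (cmod w)\<^sup>2) * (1 / (1 - cmod w)) ^ k"
proof -
  define s where "s = 1 - (cmod w)\<^sup>2"
  define A where "A = 1 - (cmod (f w))\<^sup>2"
  define g where "g = (\<lambda>z. f (Moebius_function 0 (-w) z))"
  \<comment> \<open>The automorphism sending \<open>w\<close> to 0, written in the displacement
    \<open>u\<close> from \<open>w\<close>: the denominator 1 - cnj w (w + u) equals s - cnj w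
    u.\<close>
  define \<phi> where "\<phi> = (\<lambda>u. u / (of_real s - cnj w * u))"
  define D where "D = fps_const (of_real s) - fps_const (cnj w) * fps_X"
  define P where "P = fps_X / D"
  define G where "G = fps_expansion g 0"
  have s: "0 < s"
    using w by (simp add: s_def abs_square_less_1)
  have ws: "w * cnj w = 1 - of_real s"
    by (simp add: s_def complex_norm_square[symmetric])
  have g: "g \<in> schur_class"
    unfolding g_def using w by (intro schur_class_comp_Moebius f) simp
  have g0: "g 0 = f w"
    by (simp add: g_def Moebius_function_simple)
  have D0: "fps_nth D 0 \<noteq> 0"
    using s by (simp add: D_def)
  have \<phi>: "\<phi> has_fps_expansion P"
    unfolding \<phi>_def P_def D_def
    by (intro fps_expansion_intros) (use D0 in \<open>simp add: D_def\<close>)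
  have PD: "P * D = fps_X"
    using D0 by (simp add: P_def fps_divide_unit mult.assoc inverse_mult_eq_1)
  have P0: "fps_nth P 0 = 0"
    using D0 by (simp add: P_def fps_divide_unit)
  have "g has_fps_expansion G"
    using schur_class_has_fps_expansion[OF g, of 0] by (simp add: G_def)
  then have "(g \<circ> \<phi>) has_fps_expansion (G oo P)"
    by (rule has_fps_expansion_compose[OF _ \<phi> P0])
  moreover have "\<forall>\<^sub>F u in nhds 0. (g \<circ> \<phi>) u = f (w + u)"
  \<comment> \<open>The identity is needed only near 0, where the denominator of
    \<open>\<phi>\<close> does not vanish; this already determines the Taylor coefficients.\<close>
  proof -
    have "((\<lambda>u. of_real s - cnj w * u) \<longlongrightarrow> of_real s - cnj w * 0) (nhds 0)"
      by (intro tendsto_intros filterlim_ident)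
    then have "\<forall>\<^sub>F u in nhds 0. of_real s - cnj w * u \<noteq> 0"
      using s by (intro tendsto_imp_eventually_ne) auto
    then show ?thesis
    proof eventually_elim
      case (elim u)
      have "\<phi> u + w = of_real s * (w + u) / (of_real s - cnj w * u)"
      proof -
        have "u + w * (of_real s - cnj w * u) = u + of_real s * w - (w * cnj w) * u"
          by (simp add: algebra_simps)
        also have "\<dots> = of_real s * (w + u)"
          by (simp add: ws algebra_simps)
        finally have "of_real s * (w + u) / (of_real s - cnj w * u) =
            (u + w * (of_real s - cnj w * u)) / (of_real s - cnj w * u)"
          by simp
        also have "\<dots> = \<phi> u + w"
          using elim by (simp add: \<phi>_def add_divide_distrib)
        finally show ?thesis ..
      qed
      moreover have "1 + cnj w * \<phi> u = of_real s / (of_real s - cnj w * u)"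
        using elim by (simp add: \<phi>_def field_simps)
      ultimately show ?case
        using s elim by (simp add: g_def Moebius_function_simple)
    qed
  qed
  ultimately have "(\<lambda>u. f (w + u)) has_fps_expansion (G oo P)"
    by (subst has_fps_expansion_cong[OF _ refl, of _ "g \<circ> \<phi>"]) (auto elim: eventually_mono)
  from fps_nth_fps_expansion[OF this, of "Suc k"]
  have "(deriv ^^ Suc k) f w / fact (Suc k) = fps_nth (G oo P) (Suc k)"
    by (subst higher_deriv_shift_0) (simp add: o_def)
  also have "\<dots> = (\<Sum>n\<le>Suc k. fps_nth G n * fps_nth (P ^ n) (Suc k))"
    by (simp add: fps_compose_nth atLeast0AtMost)
  \<comment> \<open>The constant coefficient of \<open>G\<close> does not contribute at index
    \<open>Suc k\<close>, so every remaining coefficient of \<open>G\<close> is subject to the bound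
    \<open>A\<close>.\<close>
  also have "\<dots> = (\<Sum>n\<le>k. fps_nth G (Suc n) * fps_nth (P ^ Suc n) (Suc k))"
    by (subst sum.atMost_Suc_shift) simp
  finally have "cmod ((deriv ^^ Suc k) f w / fact (Suc k)) \<le>
      (\<Sum>n\<le>k. cmod (fps_nth G (Suc n) * fps_nth (P ^ Suc n) (Suc k)))"
    by (simp only: norm_sum)
  also have "\<dots> \<le> (\<Sum>n\<le>k. A * cmod (fps_nth (P ^ Suc n) (Suc k)))"
  proof (rule sum_mono)
    fix n
    have "cmod (fps_nth G (Suc n)) \<le> A"
      using schur_class_coeff_bound[OF g, of "Suc n"]
      by (simp only: G_def fps_expansion_def fps_nth_Abs_fps A_def g0 zero_less_Suc)
    then show "cmod (fps_nth G (Suc n) * fps_nth (P ^ Suc n) (Suc k)) \<le>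
        A * cmod (fps_nth (P ^ Suc n) (Suc k))"
      by (simp add: norm_mult mult_right_mono del: power_Suc)
  qed
  also have "\<dots> = A * (\<Sum>n\<le>k. cmod (fps_nth (P ^ Suc n) (Suc k)))"
    by (simp add: sum_distrib_left)
  also have "\<dots> \<le> A * (((1 + cmod (cnj w)) / s) ^ k / s)"
  proof (intro mult_left_mono sum_norm_power_Moebius_fps_le)
    show "P * (fps_const (of_real s) - fps_const (cnj w) * fps_X) = fps_X"
      using PD by (simp add: D_def)
    have "cmod (f w) < 1"
      using f w by (auto simp: schur_class_def)
    then show "0 \<le> A"
      by (simp add: A_def abs_square_le_1)
  qed (fact s)
  also have "(1 + cmod (cnj w)) / s = 1 / (1 - cmod w)"
  proof -
    have "s = (1 + cmod w) * (1 - cmod w)"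
      by (simp add: s_def power2_eq_square algebra_simps)
    moreover have "1 + cmod w \<noteq> 0"
      using norm_ge_zero[of w] by linarith
    ultimately show ?thesis
      by simp
  qed
  finally show ?thesis
    by (simp add: A_def s_def)
qed

section \<open>Sign of \<open>psi\<close> around its minimum root\<close>

text \<open>As long as r^m + r stays at most 1, both factors of the subtracted product are
  nonnegative and decreasing in r, while 2 r^2 strictly increases.\<close>

lemma psi_strict_mono:
  assumes r: "0 \<le> r" "r < t" "t \<le> 1" "t ^ m + t \<le> 1"
  shows "psi m r < psi m t"
proof -
  have "r ^ m \<le> t ^ m" "r ^ (2 * m) \<le> t ^ (2 * m)" "t ^ (2 * m) \<le> 1"
    using r by (auto intro: power_mono power_le_one)
  then have "(1 - t ^ (2 * m)) * (1 - t ^ m - t) \<le> (1 - r ^ (2 * m)) * (1 - r ^ m - r)"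
    using r by (intro mult_mono) auto
  moreover have "r\<^sup>2 < t\<^sup>2"
    using r by (intro power_strict_mono) auto
  ultimately show ?thesis
    by (simp add: psi_def)
qed

text \<open>Since \<open>psi\<close> is -1 at 0, a positive value would force, by the intermediate
  value theorem, a root strictly before \<open>R2 m\<close>.\<close>

lemma psi_nonpos:
  assumes m: "m \<ge> 1" and r: "0 \<le> r" "r \<le> R2 m"
  shows "psi m r \<le> 0"
proof (rule ccontr)
  assume "\<not> psi m r \<le> 0"
  moreover have "psi m 0 = -1"
    using m by (simp add: psi_def power_0_left)
  moreover have "continuous_on {0..r} (psi m)"
    unfolding psi_def by (intro continuous_intros)
  ultimately obtain x where x: "0 \<le> x" "x \<le> r" "psi m x = 0"
    using IVT'[of "psi m" 0 0 r] r by auto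
  then have "0 < x"
    using \<open>psi m 0 = -1\<close> by (cases "x = 0") auto
  then have "x = r"
    using R2_is_min_root(3)[OF m] x r by force
  then show False
    using x \<open>\<not> psi m r \<le> 0\<close> by simp
qed

text \<open>Otherwise the subtracted product would be nonpositive and \<open>psi\<close> at least 2
  r^2 > 0. The inequality is what makes the majorizing geometric series converge.\<close>

lemma power_add_less_one_if_psi_nonpos:
  assumes "0 < r" "r < 1" "psi m r \<le> 0"
  shows "r ^ m + r < 1"
proof (rule ccontr)
  assume "\<not> r ^ m + r < 1"
  moreover have "r ^ (2 * m) \<le> 1"
    using assms by (intro power_le_one) auto
  ultimately have "(1 - r ^ (2 * m)) * (1 - r ^ m - r) \<le> 0"
    by (intro mult_nonneg_nonpos) auto
  moreover have "0 < r\<^sup>2"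
    using assms by simp
  ultimately show False
    using assms(3) unfolding psi_def by linarith
qed

section \<open>The Bohr inequality up to the radius \<open>R2 m\<close>\<close>

lemma bohr_sum_le_1:
  assumes m: "m \<ge> 1" and f: "f \<in> schur_class" and z: "cmod z \<le> R2 m"
  shows "bohr_sum m f z \<le> 1"
proof (cases "z = 0")
  case True
  have "cmod (f 0) < 1"
    using f by (auto simp: schur_class_def)
  then show ?thesis
    using True m by (simp add: bohr_sum_def power_0_left)
next
  case False
  define r where "r = cmod z"
  define w where "w = z ^ m"
  define \<rho> where "\<rho> = r ^ m"
  define x where "x = cmod (f w)"
  define B where "B = (1 - x\<^sup>2) / (1 - \<rho>\<^sup>2)"
  have r: "0 < r" "r < 1"
    using False z R2_is_min_root(4)[OF m] by (auto simp: r_def)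
  have psi: "psi m r \<le> 0"
    using psi_nonpos[OF m] z by (simp add: r_def)
  have \<rho>r: "\<rho> + r < 1"
    using power_add_less_one_if_psi_nonpos[OF r psi] by (simp add: \<rho>_def)
  have \<rho>0: "0 < \<rho>"
    using r by (simp add: \<rho>_def)
  have \<rho>1: "\<rho> < 1"
    using \<rho>r r by simp
  have w: "cmod w = \<rho>"
    by (simp add: w_def \<rho>_def r_def norm_power)
  have x: "0 \<le> x" "x < 1"
    using f w \<rho>1 by (auto simp: x_def schur_class_def)
  have \<rho>2: "0 < 1 - \<rho>\<^sup>2"
    using \<rho>0 \<rho>1 by (simp add: abs_square_less_1)
  have B: "0 \<le> B"
    unfolding B_def using x \<rho>2 by (intro divide_nonneg_pos) (auto simp: abs_square_le_1)
  \<comment> \<open>Ratio of the majorizing geometric series; \<open>q < 1\<close> amounts to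
    \<open>\<rho> + r < 1\<close>. As the series starts at the second derivative, its first term is
    \<open>B * r * q\<close>.\<close>
  define q where "q = r / (1 - \<rho>)"
  have q: "0 \<le> q" "q < 1"
    using r \<rho>r \<rho>1 by (auto simp: q_def field_simps)
  have "(\<Sum>k. ennreal (cmod ((deriv ^^ (k + 2)) f w / fact (k + 2)) * r ^ (k + 2))) \<le>
      (\<Sum>k. ennreal (B * r * q * q ^ k))"
  proof (intro suminf_le ennreal_leI)
    fix k
    have "cmod ((deriv ^^ (k + 2)) f w / fact (k + 2)) \<le> B * (1 / (1 - \<rho>)) ^ Suc k"
      using schur_class_higher_deriv_bound_at[OF f, of w "Suc k"] w \<rho>1
      by (simp only: B_def x_def add_2_eq_Suc')
    then have "cmod ((deriv ^^ (k + 2)) f w / fact (k + 2)) * r ^ (k + 2) \<le>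
        B * (1 / (1 - \<rho>)) ^ Suc k * r ^ (k + 2)"
      using r by (intro mult_right_mono) auto
    also have "\<dots> = B * r * q * q ^ k"
      by (simp add: q_def power_divide)
    finally show "cmod ((deriv ^^ (k + 2)) f w / fact (k + 2)) * r ^ (k + 2) \<le> B * r * q * q ^ k" .
  qed auto
  also have "\<dots> = ennreal (B * r * q * (1 / (1 - q)))"
    using B r q by (intro suminf_ennreal_eq sums_mult geometric_sums) auto
  finally have "bohr_sum m f z \<le> ennreal x + ennreal (B * r * q * (1 / (1 - q)))"
    unfolding bohr_sum_def w_def[symmetric] r_def[symmetric] x_def[symmetric]
    by (rule add_left_mono)
  also have "\<dots> = ennreal (x + B * r * q * (1 / (1 - q)))"
    using x B r q by (intro ennreal_plus[symmetric]) auto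
  also have "\<dots> \<le> ennreal 1"
  proof (rule ennreal_leI)
    have "1 - q = (1 - \<rho> - r) / (1 - \<rho>)"
      using \<rho>1 by (simp add: q_def field_simps)
    then have "r * q * (1 / (1 - q)) = r\<^sup>2 / (1 - \<rho> - r)"
      using \<rho>1 by (simp add: q_def power2_eq_square)
    then have "B * (r * q * (1 / (1 - q))) = B * (r\<^sup>2 / (1 - \<rho> - r))"
      by (rule arg_cong)
    then have "B * r * q * (1 / (1 - q)) = (1 - x\<^sup>2) * (r\<^sup>2 / ((1 - \<rho>\<^sup>2) * (1 - \<rho> - r)))"
      by (simp add: B_def)
    also have "\<dots> \<le> (1 - x\<^sup>2) * (1 / 2)"
    proof (rule mult_left_mono)
      have "2 * r\<^sup>2 \<le> (1 - \<rho>\<^sup>2) * (1 - \<rho> - r)"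
        using psi by (simp add: psi_def \<rho>_def power_mult[symmetric] mult.commute)
      moreover have "0 < (1 - \<rho>\<^sup>2) * (1 - \<rho> - r)"
        using \<rho>2 \<rho>r by simp
      ultimately show "r\<^sup>2 / ((1 - \<rho>\<^sup>2) * (1 - \<rho> - r)) \<le> 1 / 2"
        by (simp add: divide_le_eq)
      show "0 \<le> 1 - x\<^sup>2"
        using x by (simp add: abs_square_le_1)
    qed
    also have "\<dots> \<le> 1 - x"
      using zero_le_power2[of "1 - x"] by (simp add: power2_eq_square field_simps)
    finally show "x + B * r * q * (1 / (1 - q)) \<le> 1"
      by simp
  qed
  finally show ?thesis by simp
qed

section \<open>Sharpness through disc automorphisms\<close>

text \<open>Here \<open>f\<close> is (a - z) / (1 - a z). Its partial fraction form in the
  displacement \<open>u\<close> from \<open>w\<close> is a constant minus a multiple of 1 / (1 - (a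
  / d) u) with d = 1 - a w, so the coefficients are those of a geometric series.\<close>

lemma higher_deriv_extremal:
  fixes a w :: real
  assumes a: "0 < a" and d: "a * w < 1"
  defines "f \<equiv> \<lambda>z. - Moebius_function 0 (of_real a) z"
  shows "(deriv ^^ Suc k) f (of_real w) / fact (Suc k) =
    - of_real ((1 - a\<^sup>2) * a ^ k / (1 - a * w) ^ (k + 2))"
proof -
  define d where "d = 1 - a * w"
  have d0: "d > 0"
    using assms by (simp add: d_def)
  define D :: "complex fps" where "D = 1 - fps_const (of_real (a / d)) * fps_X"
  define F where "F = fps_const (1 / of_real a) - fps_const (of_real ((1 - a\<^sup>2) / (a * d))) * inverse D"
  have D: "inverse D = Abs_fps (\<lambda>n. of_real (a / d) ^ n)"
  proof (rule fps_inverse_unique, rule fps_ext)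
    fix n
    show "fps_nth (D * Abs_fps (\<lambda>n. of_real (a / d) ^ n)) n = fps_nth 1 n"
      by (cases n) (simp_all add: D_def left_diff_distrib mult.assoc)
  qed
  have "(\<lambda>u. 1 / of_real a - of_real ((1 - a\<^sup>2) / (a * d)) * inverse (1 - of_real (a / d) * u))
      has_fps_expansion F"
    unfolding F_def D_def by (intro fps_expansion_intros) simp
  moreover have "\<forall>\<^sub>F u in nhds 0.
    1 / of_real a - of_real ((1 - a\<^sup>2) / (a * d)) * inverse (1 - of_real (a / d) * u) = f (of_real w + u)"
  proof -
    have "((\<lambda>u. of_real d - of_real a * u) \<longlongrightarrow> of_real d - of_real a * (0::complex)) (nhds 0)"
      by (intro tendsto_intros filterlim_ident)
    then have "\<forall>\<^sub>F u in nhds 0. of_real d - of_real a * u \<noteq> (0::complex)"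
      using d0 by (intro tendsto_imp_eventually_ne) auto
    then show ?thesis
    proof eventually_elim
      case (elim u)
      have "1 - of_real (a / d) * u = (of_real d - of_real a * u) / of_real d"
        using d0 by (simp add: field_simps)
      then have 1: "of_real ((1 - a\<^sup>2) / (a * d)) * inverse (1 - of_real (a / d) * u) =
          (1 - (of_real a)\<^sup>2) / (of_real a * (of_real d - of_real a * u))"
        using d0 by simp
      have 2: "1 - of_real a * (of_real w + u) = of_real d - of_real a * u"
        by (simp add: d_def algebra_simps)
      have "f (of_real w + u) = - ((of_real w + u - of_real a) / (of_real d - of_real a * u))"
        by (simp add: f_def Moebius_function_simple 2)
      also have "\<dots> = 1 / of_real a - (1 - (of_real a)\<^sup>2) / (of_real a * (of_real d - of_real a * u))"
        using elim a by (simp add: divide_simps) (simp add: d_def algebra_simps power2_eq_square)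
      finally show ?case
        by (simp only: 1)
    qed
  qed
  ultimately have "(\<lambda>u. f (of_real w + u)) has_fps_expansion F"
    by (subst has_fps_expansion_cong[OF _ refl]) (auto elim: eventually_mono)
  from fps_nth_fps_expansion[OF this, of "Suc k"]
  have "(deriv ^^ Suc k) f (of_real w) / fact (Suc k) = fps_nth F (Suc k)"
    by (subst higher_deriv_shift_0) (simp add: o_def)
  also have "\<dots> = - of_real ((1 - a\<^sup>2) * a ^ k / d ^ (k + 2))"
    using a d0 by (simp add: F_def D power_divide)
  finally show ?thesis
    by (simp add: d_def)
qed

lemma bohr_sum_extremal_gt_1:
  assumes r: "0 < r" "r ^ m + r < 1" "0 < psi m r"
  shows "\<exists>f\<in>schur_class. bohr_sum m f (of_real r) > 1"
proof -
  define \<rho> where "\<rho> = r ^ m"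
  have \<rho>: "0 < \<rho>" "\<rho> + r < 1"
    using r by (auto simp: \<rho>_def)
  \<comment> \<open>For \<open>a\<close> in the range chosen below, the Bohr sum at \<open>r\<close>
    exceeds 1 by \<open>H a\<close> times the positive factor (1 - a) / (d^2 (d - a r)), where d = 1
    - a \<rho>. At \<open>a = 1\<close> that factor vanishes but \<open>H\<close> equals
    \<open>psi m r\<close>, so \<open>a\<close> is taken slightly below 1.\<close>
  define H where "H = (\<lambda>a. (1 + a) * a * r\<^sup>2 - (1 + \<rho>) * (1 - a * \<rho>) * (1 - a * \<rho> - a * r))"
  have "H 1 = psi m r"
    by (simp add: H_def psi_def \<rho>_def power_mult power2_eq_square algebra_simps power_mult_distrib)
  moreover have "(H \<longlongrightarrow> H 1) (at_left 1)"
    unfolding H_def by (intro tendsto_intros)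
  ultimately have "\<forall>\<^sub>F a in at_left 1. 0 < H a"
    using r order_tendstoD(1)[of H "H 1" "at_left 1" 0] by simp
  \<comment> \<open>With \<open>a > \<rho>\<close> the value of the extremal function at
    \<open>\<rho>\<close> is positive and equals its modulus.\<close>
  moreover have "\<forall>\<^sub>F a in at_left 1. a \<in> {\<rho><..<1}"
    using \<rho> r by (intro eventually_at_left_real) auto
  ultimately have "\<forall>\<^sub>F a in at_left (1::real). 0 < H a \<and> a \<in> {\<rho><..<1}"
    by (rule eventually_conj)
  then obtain a where a: "0 < H a" "\<rho> < a" "a < 1"
    using eventually_happens by fastforce
  define f where "f = (\<lambda>z. - Moebius_function 0 (of_real a) z)"
  define d where "d = 1 - a * \<rho>"
  have a0: "0 < a"
    using a \<rho> by simp
  have "a * (\<rho> + r) \<le> 1 * (\<rho> + r)"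
    using a \<rho> r by (intro mult_right_mono) auto
  then have dr: "a * r < d"
    using \<rho> by (simp add: d_def algebra_simps)
  have d: "0 < d"
    using dr a0 r mult_pos_pos[of a r] by linarith
  define q where "q = a * r / d"
  have q: "0 < q" "q < 1"
    using a0 r d dr by (auto simp: q_def)
  have fS: "f \<in> schur_class"
    using Moebius_function_holomorphic[of "of_real a" 0] Moebius_function_norm_lt_1[of "of_real a" _ 0] a a0
    by (auto simp: f_def schur_class_def intro!: holomorphic_intros)
  have z: "(of_real r :: complex) ^ m = of_real \<rho>"
    by (simp add: \<rho>_def)
  have fz: "cmod (f (of_real \<rho>)) = (a - \<rho>) / d"
  proof -
    have "f (of_real \<rho>) = of_real ((a - \<rho>) / d)"
      by (simp add: f_def Moebius_function_simple d_def minus_divide_left)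
    then show ?thesis
      using a d by (simp only: norm_of_real) simp
  qed
  \<comment> \<open>The term with k = 0 of the series of derivatives, which is exactly geometric
    with ratio \<open>q\<close>.\<close>
  define C where "C = (1 - a\<^sup>2) * r / d\<^sup>2 * q"
  have a2: "0 < 1 - a\<^sup>2"
    using a a0 by (simp add: abs_square_less_1)
  have C: "0 < C"
    using a2 r d q by (simp add: C_def)
  have "cmod ((deriv ^^ (k + 2)) f (of_real \<rho>) / fact (k + 2)) * r ^ (k + 2) = C * q ^ k" for k
  proof -
    have "cmod ((deriv ^^ (k + 2)) f (of_real \<rho>) / fact (k + 2)) = (1 - a\<^sup>2) * a ^ Suc k / d ^ (Suc k + 2)"
    proof -
      have "a * \<rho> < 1"
        using d by (simp add: d_def)
      from higher_deriv_extremal[OF a0 this, of "Suc k"]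
      have "(deriv ^^ (k + 2)) f (of_real \<rho>) / fact (k + 2) =
          - of_real ((1 - a\<^sup>2) * a ^ Suc k / d ^ (Suc k + 2))"
        by (simp only: f_def d_def add_2_eq_Suc')
      then show ?thesis
        using a2 a0 d by (simp only: norm_minus_cancel norm_of_real) simp
    qed
    then show ?thesis
      using d by (simp add: C_def q_def power_divide power_mult_distrib power2_eq_square mult_ac)
  qed
  then have "bohr_sum m f (of_real r) = ennreal ((a - \<rho>) / d) + (\<Sum>k. ennreal (C * q ^ k))"
    unfolding bohr_sum_def z fz using r by simp
  also have "(\<Sum>k. ennreal (C * q ^ k)) = ennreal (C * (1 / (1 - q)))"
    using C q by (intro suminf_ennreal_eq sums_mult geometric_sums) auto
  also have "ennreal ((a - \<rho>) / d) + \<dots> = ennreal ((a - \<rho>) / d + C * (1 / (1 - q)))"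
    using a d C q by (intro ennreal_plus[symmetric]) auto
  also have "\<dots> > ennreal 1"
  proof (rule ennreal_lessI)
    have 1: "1 - (a - \<rho>) / d = (1 - a) * (1 + \<rho>) / d"
      using d by (simp add: field_simps) (simp add: d_def algebra_simps)
    have "1 - q = (d - a * r) / d"
      using d by (simp add: q_def field_simps)
    then have 2: "C * (1 / (1 - q)) = (1 - a) * ((1 + a) * a * r\<^sup>2) / (d\<^sup>2 * (d - a * r))"
      using d by (simp add: C_def q_def power2_eq_square) (simp add: algebra_simps)
    have "(1 + \<rho>) * d * (d - a * r) < (1 + a) * a * r\<^sup>2"
      using a by (simp add: H_def d_def)
    then have "(1 + \<rho>) / d < (1 + a) * a * r\<^sup>2 / (d\<^sup>2 * (d - a * r))"
      using d dr by (simp add: divide_simps power2_eq_square)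
    then have "(1 - a) * ((1 + \<rho>) / d) < (1 - a) * ((1 + a) * a * r\<^sup>2 / (d\<^sup>2 * (d - a * r)))"
      using a by (intro mult_strict_left_mono) auto
    then show "1 < (a - \<rho>) / d + C * (1 / (1 - q))"
      using 1 2 by simp
    then show "0 < (a - \<rho>) / d + C * (1 / (1 - q))"
      by simp
  qed
  finally show ?thesis
    using fS by auto
qed

theorem theorem3:
  fixes m :: nat
  assumes "m \<ge> 1"
  shows "(\<forall>f\<in>schur_class. \<forall>z\<in>ball 0 1. cmod z \<le> R2 m \<longrightarrow> bohr_sum m f z \<le> 1) \<and>
    (\<forall>R'. R2 m < R' \<and> R' < 1 \<longrightarrow>
       (\<exists>f\<in>schur_class. \<exists>z. cmod z \<le> R' \<and> bohr_sum m f z > 1))"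
proof (intro conjI allI ballI impI)
  fix f z assume "f \<in> schur_class" "cmod z \<le> R2 m"
  then show "bohr_sum m f z \<le> 1"
    using bohr_sum_le_1[OF assms] by simp
next
  fix R' assume R': "R2 m < R' \<and> R' < 1"
  note R2 = R2_is_min_root[OF assms]
  \<comment> \<open>A strict inequality at the root, so it persists slightly to the right by
    continuity.\<close>
  have "R2 m ^ m + R2 m < 1"
    using R2 by (intro power_add_less_one_if_psi_nonpos) auto
  moreover have "((\<lambda>r. r ^ m + r) \<longlongrightarrow> R2 m ^ m + R2 m) (at_right (R2 m))"
    by (intro tendsto_intros)
  ultimately have "\<forall>\<^sub>F r in at_right (R2 m). r ^ m + r < 1"
    by (intro order_tendstoD)
  moreover have "\<forall>\<^sub>F r in at_right (R2 m). r \<in> {R2 m<..<R'}"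
    using R' by (intro eventually_at_right_real) auto
  ultimately have "\<forall>\<^sub>F r in at_right (R2 m). r ^ m + r < 1 \<and> r \<in> {R2 m<..<R'}"
    by (rule eventually_conj)
  then obtain r where r: "r ^ m + r < 1" "R2 m < r" "r < R'"
    using eventually_happens by fastforce
  \<comment> \<open>Minimality of the root alone would not exclude that \<open>psi\<close> is again
    negative just beyond it; strict monotonicity does.\<close>
  have "0 < psi m r"
    using psi_strict_mono[of "R2 m" r m] R2 r R' by simp
  then obtain f where "f \<in> schur_class" "bohr_sum m f (of_real r) > 1"
    using bohr_sum_extremal_gt_1[of r m] r R2(1) by auto
  moreover have "cmod (of_real r) \<le> R'"
    using r R2(1) by simp
  ultimately show "\<exists>f\<in>schur_class. \<exists>z. cmod z \<le> R' \<and> bohr_sum m f z > 1"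
    by blast
qed

end
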